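(* Let $(E,\|\cdot\|_E)$ be a smooth locally uniformly rotund Banach space and let $K\subset E$ be a compact subset which, with the metric induced by the norm, has property $(Z)$. Then $K$ is convex.
   Context: A metric space $(K,\rho)$ has property $(Z)$ if for all distinct $t,\tau\in K$ and every $\varepsilon>0$ there is some $z\in K\setminus\{t,\tau\}$ satisfying $$\rho(t,z)+\rho(z,\tau)\le\rho(t,\tau)+\varepsilon\min\{\rho(z,t),\rho(z,\tau)\}.$$ A Banach space $(E,\|\cdot\|_E)$ with closed unit ball $B_E$ and unit sphere $S_E$ is locally uniformly rotund if for each $x\in S_E$ and $\eta>0$ there is some $\delta=\delta_x(\eta)>0$ such that $\|x-y\|_E\le\eta$ whenever $y\in B_E$ and $\|\frac12(x+y)\|_E\ge 1-\delta$. *)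

theory Defs
  imports "HOL-Analysis.Analysis"
begin

text \<open>
  Property (Z) of a set \<open>K\<close>, regarded as a metric space with the metric inherited
  from the ambient type.
\<close>

definition property_Z :: "'a::metric_space set \<Rightarrow> bool" where
  "property_Z K \<longleftrightarrow>
    (\<forall>t\<in>K. \<forall>\<tau>\<in>K. t \<noteq> \<tau> \<longrightarrow>
      (\<forall>\<epsilon>::real. \<epsilon> > 0 \<longrightarrow>
        (\<exists>z\<in>K - {t, \<tau>}.
          dist t z + dist z \<tau> \<le> dist t \<tau> + \<epsilon> * min (dist z t) (dist z \<tau>))))"

text \<open>
  In the next two definitions the space is the whole type, passed as \<open>TYPE('e)\<close>;
  \<open>sphere 0 1\<close> and \<open>cball 0 1\<close> are its unit sphere and closed unit ball.
\<close>

definition locally_uniformly_rotund :: "'e::real_normed_vector itself \<Rightarrow> bool" where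
  "locally_uniformly_rotund _ \<longleftrightarrow>
    (\<forall>x\<in>sphere (0::'e) 1. \<forall>\<eta>::real. \<eta> > 0 \<longrightarrow>
      (\<exists>\<delta>::real. \<delta> > 0 \<and>
        (\<forall>y\<in>cball (0::'e) 1. norm ((1/2) *\<^sub>R (x + y)) \<ge> 1 - \<delta> \<longrightarrow> norm (x - y) \<le> \<eta>)))"

text \<open>
  Smoothness in the sense of Day: every point of the unit sphere has exactly one norm-one
  supporting functional. For norms this is equivalent to Gateaux differentiability
  away from the origin.
\<close>

definition smooth_space :: "'e::real_normed_vector itself \<Rightarrow> bool" where
  "smooth_space _ \<longleftrightarrow>
    (\<forall>x\<in>sphere (0::'e) 1. \<exists>!f :: 'e \<Rightarrow>\<^sub>L real. norm f = 1 \<and> blinfun_apply f x = 1)"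

end

theory Submission
  imports Defs
begin

text \<open>
  Write \<open>d\<close> for the distance function of \<open>K\<close>.

  Property (Z) makes nearest points unique. Suppose that \<open>t\<close> and \<open>\<tau>\<close> are two nearest points to
  \<open>x\<close>. The open ball about \<open>x\<close> of radius \<open>d x\<close> misses \<open>K\<close>, and by rotundity it contains the open
  segment between \<open>t\<close> and \<open>\<tau>\<close>. Property (Z) with small \<open>\<epsilon>\<close> supplies a point \<open>z\<close> of \<open>K\<close> which, seen
  from the closer endpoint, lies nearly in the direction of the other endpoint: local uniform
  rotundity turns the near-equality in the triangle inequality into closeness of directions. Such
  a \<open>z\<close> falls into the open ball, a contradiction. This is \<open>near_chord_in_ball\<close> and
  \<open>property_Z_nearest_points_unique\<close>.

  It remains to see that a compact set \<open>K\<close> with unique nearest points in a smooth space is convex,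
  which is a theorem of Vlasov; local uniform rotundity shortens its proof. Let \<open>p\<close> be the point of \<open>K\<close> nearest to
  \<open>x \<notin> K\<close>. By compactness the nearest point depends continuously on \<open>x\<close>, so \<open>d\<close> grows with
  slope nearly \<open>1\<close> along a short step from \<open>x\<close> away from \<open>p\<close>
  (\<open>infdist_grows_away_from_nearest\<close>). Ekeland's variational principle concatenates such steps:
  for every \<open>R > 0\<close> and \<open>\<sigma> < 1\<close> some \<open>y\<close> at distance \<open>R\<close> from \<open>x\<close> has \<open>d y \<ge> d x + \<sigma> * R\<close>
  (\<open>infdist_steep_far_point\<close>). As \<open>\<sigma>\<close> tends to \<open>1\<close>, the points \<open>p\<close>, \<open>x\<close>, \<open>y\<close> become metrically
  collinear, and local uniform rotundity forces \<open>y\<close> towards the ray from \<open>p\<close> through \<open>x\<close>. Hence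
  \<open>d\<close> has slope exactly \<open>1\<close> along this ray beyond \<open>x\<close> (\<open>infdist_along_ray\<close>), and the open balls with
  \<open>p\<close> on their boundary whose centres lie there all miss \<open>K\<close>. In a smooth space these balls fill the open
  half-space bounded by the supporting hyperplane at \<open>p\<close>, so this hyperplane separates \<open>x\<close> from
  \<open>K\<close> (\<open>nearest_point_separates\<close>).

  The half-space argument needs smoothness in the form \<open>norm_decreases_if_smooth\<close>: if \<open>f\<close> supports
  the ball at \<open>u\<close> and \<open>f w > 0\<close>, then moving from \<open>u\<close> in direction \<open>-w\<close> enters the open ball. If it
  did not, the Hahn--Banach theorem would give a second supporting functional at \<open>u\<close>.
\<close>

section \<open>Sublinear functionals and the Hahn--Banach theorem\<close>

text \<open>
  The inequality for positive factors passes to infima at once; with \<open>c\<close> and \<open>1/c\<close> it implies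
  the usual positive homogeneity.
\<close>
definition sublinear :: "('a::real_vector \<Rightarrow> real) \<Rightarrow> bool" where
  "sublinear p \<longleftrightarrow> (\<forall>x y. p (x + y) \<le> p x + p y) \<and> (\<forall>c>0. \<forall>x. p (c *\<^sub>R x) \<le> c * p x)"

lemma sublinear_add: "sublinear p \<Longrightarrow> p (x + y) \<le> p x + p y"
  by (auto simp: sublinear_def)

lemma sublinear_zero:
  assumes "sublinear p"
  shows "p 0 = 0"
proof -
  have "p 0 \<le> 2 * p 0" using sublinear_add[OF assms, of 0 0] by simp
  moreover have "p ((1/2) *\<^sub>R 0) \<le> (1/2) * p 0"
    using assms unfolding sublinear_def by (metis half_gt_zero_iff zero_less_one)
  ultimately show ?thesis by simp
qed

lemma sublinear_scale:
  assumes "sublinear p" and "c \<ge> 0"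
  shows "p (c *\<^sub>R x) = c * p x"
proof (cases "c = 0")
  case True
  then show ?thesis using sublinear_zero[OF assms(1)] by simp
next
  case False
  then have c: "c > 0" using assms(2) by simp
  have "p (c *\<^sub>R x) \<le> c * p x" using assms(1) c by (auto simp: sublinear_def)
  moreover have "p (inverse c *\<^sub>R (c *\<^sub>R x)) \<le> inverse c * p (c *\<^sub>R x)"
    using assms(1) c unfolding sublinear_def by (meson inverse_positive_iff_positive)
  then have "c * p x \<le> p (c *\<^sub>R x)"
    using c by (simp add: field_simps)
  ultimately show ?thesis by simp
qed

lemma sublinear_minus_le:
  assumes "sublinear p"
  shows "- p (- x) \<le> p x"
  using sublinear_add[OF assms, of x "- x"] sublinear_zero[OF assms] by simp

text \<open>
  Both infima needed below, over a chain and over a convex cone, are instances: the two conditions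
  say that the family absorbs addition and scaling up to passing to another index.
\<close>
lemma sublinear_INF:
  fixes p :: "'i \<Rightarrow> 'a::real_vector \<Rightarrow> real"
  assumes ne: "I \<noteq> {}"
    and bdd: "\<And>x. bdd_below ((\<lambda>i. p i x) ` I)"
    and add: "\<And>i j x y. i \<in> I \<Longrightarrow> j \<in> I \<Longrightarrow> \<exists>k\<in>I. p k (x + y) \<le> p i x + p j y"
    and scale: "\<And>i c x. i \<in> I \<Longrightarrow> c > 0 \<Longrightarrow> \<exists>k\<in>I. p k (c *\<^sub>R x) \<le> c * p i x"
  shows "sublinear (\<lambda>x. INF i\<in>I. p i x)"
proof -
  define q where "q = (\<lambda>x. INF i\<in>I. p i x)"
  have low: "q x \<le> p i x" if "i \<in> I" for i x
    unfolding q_def using bdd that by (rule cINF_lower)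
  have great: "a \<le> q x" if "\<And>i. i \<in> I \<Longrightarrow> a \<le> p i x" for a x
    unfolding q_def using ne that by (rule cINF_greatest)
  have "q (x + y) \<le> q x + q y" for x y
  proof -
    have "q (x + y) - p i x \<le> q y" if "i \<in> I" for i
    proof (rule great)
      fix j assume "j \<in> I"
      then obtain k where "k \<in> I" "p k (x + y) \<le> p i x + p j y"
        using add[of i j x y] \<open>i \<in> I\<close> by metis
      then show "q (x + y) - p i x \<le> p j y" using low[of k "x + y"] by simp
    qed
    then have "q (x + y) - q y \<le> q x" by (intro great) (simp add: algebra_simps)
    then show ?thesis by simp
  qed
  moreover have "q (c *\<^sub>R x) \<le> c * q x" if "c > 0" for c x
  proof -
    have "q (c *\<^sub>R x) / c \<le> q x"
    proof (rule great)
      fix i assume "i \<in> I"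
      then obtain k where "k \<in> I" "p k (c *\<^sub>R x) \<le> c * p i x"
        using scale[of i c x] \<open>c > 0\<close> by metis
      then show "q (c *\<^sub>R x) / c \<le> p i x"
        using low[of k "c *\<^sub>R x"] that by (simp add: field_simps)
    qed
    then show ?thesis using that by (simp add: field_simps)
  qed
  ultimately have "sublinear q" unfolding sublinear_def by blast
  then show ?thesis by (simp add: q_def)
qed

text \<open>
  The infimum of \<open>p (x + c) - \<alpha>\<close> over \<open>(c, \<alpha>) \<in> C\<close> is the largest sublinear functional below \<open>p\<close>
  that forces each linear functional beneath it to be at least \<open>\<alpha>\<close> at \<open>c\<close>, because a linear functional below it
  is at most \<open>-\<alpha>\<close> at \<open>-c\<close>. The hypothesis \<open>\<alpha> \<le> p c\<close> keeps the infimum finite.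
\<close>
lemma sublinear_shrink_by_cone:
  fixes p :: "'a::real_vector \<Rightarrow> real"
  assumes p: "sublinear p"
    and zero: "(0, 0) \<in> C"
    and add: "\<And>c \<alpha> d \<beta>. (c, \<alpha>) \<in> C \<Longrightarrow> (d, \<beta>) \<in> C \<Longrightarrow> (c + d, \<alpha> + \<beta>) \<in> C"
    and scale: "\<And>c \<alpha> s. (c, \<alpha>) \<in> C \<Longrightarrow> s > 0 \<Longrightarrow> (s *\<^sub>R c, s * \<alpha>) \<in> C"
    and le: "\<And>c \<alpha>. (c, \<alpha>) \<in> C \<Longrightarrow> \<alpha> \<le> p c"
  obtains q where "sublinear q" and "q \<le> p" and "\<And>c \<alpha>. (c, \<alpha>) \<in> C \<Longrightarrow> q (- c) \<le> - \<alpha>"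
proof -
  define r where "r = (\<lambda>(c, \<alpha>) x. p (x + c) - \<alpha>)"
  have bdd: "bdd_below ((\<lambda>i. r i x) ` C)" for x
  proof (rule bdd_belowI2)
    fix i assume i: "i \<in> C"
    obtain c \<alpha> where ca: "i = (c, \<alpha>)" by (cases i)
    have "p c \<le> p (x + c) + p (- x)" using sublinear_add[OF p, of "x + c" "- x"] by simp
    then show "- p (- x) \<le> r i x" using le[of c \<alpha>] i ca by (simp add: r_def)
  qed
  have sub: "sublinear (\<lambda>x. INF i\<in>C. r i x)"
  proof (rule sublinear_INF)
    show "C \<noteq> {}" using zero by auto
    show "bdd_below ((\<lambda>i. r i x) ` C)" for x by (rule bdd)
    show "\<exists>k\<in>C. r k (x + y) \<le> r i x + r j y" if "i \<in> C" "j \<in> C" for i j x y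
    proof -
      obtain c \<alpha> d \<beta> where ij: "i = (c, \<alpha>)" "j = (d, \<beta>)" by (cases i, cases j)
      have "p (x + y + (c + d)) \<le> p (x + c) + p (y + d)"
        using sublinear_add[OF p, of "x + c" "y + d"] by (simp add: algebra_simps)
      then have "r (c + d, \<alpha> + \<beta>) (x + y) \<le> r i x + r j y" by (simp add: r_def ij)
      then show ?thesis using add that ij by blast
    qed
    show "\<exists>k\<in>C. r k (s *\<^sub>R x) \<le> s * r i x" if "i \<in> C" "s > 0" for i s x
    proof -
      obtain c \<alpha> where i: "i = (c, \<alpha>)" by (cases i)
      have "p (s *\<^sub>R x + s *\<^sub>R c) = s * p (x + c)"
        using sublinear_scale[OF p, of s "x + c"] that by (simp add: algebra_simps)
      then have "r (s *\<^sub>R c, s * \<alpha>) (s *\<^sub>R x) \<le> s * r i x" by (simp add: r_def i algebra_simps)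
      then show ?thesis using scale that i by blast
    qed
  qed
  have low: "(INF i\<in>C. r i x) \<le> p (x + c) - \<alpha>" if "(c, \<alpha>) \<in> C" for x c \<alpha>
    using cINF_lower[OF bdd that, of x] by (simp add: r_def)
  show thesis
  proof (rule that[OF sub])
    show "(\<lambda>x. INF i\<in>C. r i x) \<le> p" using low[OF zero] by (auto simp: le_fun_def)
    show "(INF i\<in>C. r i (- c)) \<le> - \<alpha>" if "(c, \<alpha>) \<in> C" for c \<alpha>
      using low[OF that, of "- c"] sublinear_zero[OF p] by simp
  qed
qed

text \<open>
  Zorn's lemma: a chain below \<open>p\<close> has its pointwise infimum as a lower bound, finite because every
  member is at least \<open>-p (-x)\<close> at \<open>x\<close>.
\<close>
lemma minimal_sublinear_exists:
  fixes p :: "'a::real_vector \<Rightarrow> real"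
  assumes p: "sublinear p"
  obtains q where "sublinear q" and "q \<le> p" and "\<And>q'. sublinear q' \<Longrightarrow> q' \<le> q \<Longrightarrow> q' = q"
proof -
  define A where "A = {q. sublinear q \<and> q \<le> p}"
  define P where "P = (\<lambda>f g :: 'a \<Rightarrow> real. g \<le> f)"
  have "\<exists>m\<in>A. \<forall>a\<in>A. P m a \<longrightarrow> a = m"
  proof (rule predicate_Zorn)
    show "partial_order_on A (relation_of P A)"
      by (rule partial_order_on_relation_ofI) (auto simp: P_def)
    fix C assume "C \<in> Chains (relation_of P A)"
    then have CA: "C \<subseteq> A" and chain: "\<And>f g. f \<in> C \<Longrightarrow> g \<in> C \<Longrightarrow> f \<le> g \<or> g \<le> f"
      by (auto simp: Chains_def relation_of_def P_def)
    show "\<exists>u\<in>A. \<forall>a\<in>C. P a u"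
    proof (cases "C = {}")
      case True
      then show ?thesis using p by (auto simp: A_def)
    next
      case False
      have bdd: "bdd_below ((\<lambda>f. f x) ` C)" for x
      proof (rule bdd_belowI2)
        fix f assume "f \<in> C"
        then have "sublinear f" "f (- x) \<le> p (- x)" using CA by (auto simp: A_def le_fun_def)
        then show "- p (- x) \<le> f x" using sublinear_minus_le[of f x] by simp
      qed
      have low: "(INF f\<in>C. f x) \<le> f x" if "f \<in> C" for f x
        using bdd that by (rule cINF_lower)
      have "sublinear (\<lambda>x. INF f\<in>C. f x)"
      proof (rule sublinear_INF[OF False bdd])
        fix f g x y assume fg: "f \<in> C" "g \<in> C"
        \<comment> \<open>In a chain the smaller of two members serves for both.\<close>
        then obtain h where h: "h \<in> C" "h \<le> f" "h \<le> g" using chain by blast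
        have "h (x + y) \<le> h x + h y" using h CA by (auto simp: A_def intro: sublinear_add)
        also have "\<dots> \<le> f x + g y" using h by (auto simp: le_fun_def intro: add_mono)
        finally show "\<exists>k\<in>C. k (x + y) \<le> f x + g y" using h by blast
      next
        fix f x and c :: real assume "f \<in> C" "c > 0"
        then show "\<exists>k\<in>C. k (c *\<^sub>R x) \<le> c * f x" using CA by (auto simp: A_def sublinear_def)
      qed
      moreover have "(INF f\<in>C. f x) \<le> p x" for x
      proof -
        obtain f where "f \<in> C" using False by blast
        then have "(INF f\<in>C. f x) \<le> f x" "f x \<le> p x"
          using low CA by (auto simp: A_def le_fun_def)
        then show ?thesis by simp
      qed
      ultimately have "(\<lambda>x. INF f\<in>C. f x) \<in> A" by (simp add: A_def le_fun_def)
      moreover have "\<forall>a\<in>C. P a (\<lambda>x. INF f\<in>C. f x)" using low by (simp add: P_def le_fun_def)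
      ultimately show ?thesis by blast
    qed
  qed
  then obtain m where "m \<in> A" "\<And>a. a \<in> A \<Longrightarrow> a \<le> m \<Longrightarrow> a = m" by (auto simp: P_def)
  then show thesis using that[of m] by (force simp: A_def)
qed

text \<open>
  Shrinking \<open>q\<close> by the ray through \<open>(a, q a)\<close> cannot make it smaller, so \<open>q (-a) \<le> -q a\<close>; a sublinear
  functional that is odd is linear.
\<close>
lemma minimal_sublinear_linear:
  fixes q :: "'a::real_vector \<Rightarrow> real"
  assumes q: "sublinear q" and min: "\<And>q'. sublinear q' \<Longrightarrow> q' \<le> q \<Longrightarrow> q' = q"
  shows "linear q"
proof -
  have minus: "q (- a) = - q a" for a
  proof -
    obtain q' where q': "sublinear q'" "q' \<le> q"
      and neg: "\<And>c \<alpha>. (c, \<alpha>) \<in> {(s *\<^sub>R a, s * q a) | s. s \<ge> 0} \<Longrightarrow> q' (- c) \<le> - \<alpha>"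
    proof (rule sublinear_shrink_by_cone[OF q, of "{(s *\<^sub>R a, s * q a) | s. s \<ge> 0}"])
      show "(c + d, \<alpha> + \<beta>) \<in> {(s *\<^sub>R a, s * q a) | s. s \<ge> 0}"
        if "(c, \<alpha>) \<in> {(s *\<^sub>R a, s * q a) | s. s \<ge> 0}" "(d, \<beta>) \<in> {(s *\<^sub>R a, s * q a) | s. s \<ge> 0}"
        for c \<alpha> d \<beta>
      proof -
        obtain s t where "s \<ge> 0" "t \<ge> 0" "c = s *\<^sub>R a" "\<alpha> = s * q a" "d = t *\<^sub>R a" "\<beta> = t * q a"
          using \<open>(c, \<alpha>) \<in> _\<close> \<open>(d, \<beta>) \<in> _\<close> by auto
        then have "(c + d, \<alpha> + \<beta>) = ((s + t) *\<^sub>R a, (s + t) * q a)" "s + t \<ge> 0"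
          by (auto simp: algebra_simps)
        then show ?thesis by blast
      qed
      show "(t *\<^sub>R c, t * \<alpha>) \<in> {(s *\<^sub>R a, s * q a) | s. s \<ge> 0}"
        if "(c, \<alpha>) \<in> {(s *\<^sub>R a, s * q a) | s. s \<ge> 0}" "t > 0" for c \<alpha> t
      proof -
        obtain s where "s \<ge> 0" "c = s *\<^sub>R a" "\<alpha> = s * q a" using \<open>(c, \<alpha>) \<in> _\<close> by auto
        then have "(t *\<^sub>R c, t * \<alpha>) = ((t * s) *\<^sub>R a, (t * s) * q a)" "t * s \<ge> 0"
          using that by auto
        then show ?thesis by blast
      qed
      show "(0, 0) \<in> {(s *\<^sub>R a, s * q a) | s. s \<ge> 0}" by (auto intro: exI[of _ 0])
    qed (auto simp: sublinear_scale[OF q])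
    have "(a, q a) \<in> {(s *\<^sub>R a, s * q a) | s. s \<ge> 0}" by (auto intro: exI[of _ 1])
    then have "q (- a) \<le> - q a" using neg min[OF q'] by blast
    then show ?thesis using sublinear_minus_le[OF q, of a] by simp
  qed
  show ?thesis
  proof (rule linearI)
    fix x y
    have "q x \<le> q (x + y) + q (- y)" using sublinear_add[OF q, of "x + y" "- y"] by simp
    then show "q (x + y) = q x + q y" using sublinear_add[OF q, of x y] minus[of y] by simp
  next
    fix c x
    show "q (c *\<^sub>R x) = c *\<^sub>R q x"
    proof (cases "c \<ge> 0")
      case True
      then show ?thesis by (simp add: sublinear_scale[OF q])
    next
      case False
      then have "q ((- c) *\<^sub>R x) = - c * q x" by (intro sublinear_scale[OF q]) simp
      then show ?thesis using minus[of "c *\<^sub>R x"] by simp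
    qed
  qed
qed

text \<open>
  A Hahn--Banach theorem in the manner of Mazur and Orlicz: a linear minorant of \<open>p\<close> is found subject to
  a convex cone of lower bounds. Shrink \<open>p\<close> so that the bounds become automatic, then pass to a
  minimal sublinear functional.
\<close>
theorem Hahn_Banach_cone:
  fixes p :: "'a::real_vector \<Rightarrow> real"
  assumes "sublinear p"
    and "(0, 0) \<in> C"
    and "\<And>c \<alpha> d \<beta>. (c, \<alpha>) \<in> C \<Longrightarrow> (d, \<beta>) \<in> C \<Longrightarrow> (c + d, \<alpha> + \<beta>) \<in> C"
    and "\<And>c \<alpha> s. (c, \<alpha>) \<in> C \<Longrightarrow> s > 0 \<Longrightarrow> (s *\<^sub>R c, s * \<alpha>) \<in> C"
    and "\<And>c \<alpha>. (c, \<alpha>) \<in> C \<Longrightarrow> \<alpha> \<le> p c"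
  obtains g where "linear g" and "\<And>x. g x \<le> p x" and "\<And>c \<alpha>. (c, \<alpha>) \<in> C \<Longrightarrow> \<alpha> \<le> g c"
proof -
  obtain q where q: "sublinear q" "q \<le> p" "\<And>c \<alpha>. (c, \<alpha>) \<in> C \<Longrightarrow> q (- c) \<le> - \<alpha>"
    by (rule sublinear_shrink_by_cone[of p C]) (use assms in blast)+
  obtain g where g: "sublinear g" "g \<le> q" "\<And>q'. sublinear q' \<Longrightarrow> q' \<le> g \<Longrightarrow> q' = g"
    by (rule minimal_sublinear_exists[OF q(1)]) blast
  have lin: "linear g" using minimal_sublinear_linear g by blast
  show thesis
  proof (rule that[OF lin])
    show "g x \<le> p x" for x using g(2) q(2) by (meson le_funD order_trans)
    show "\<alpha> \<le> g c" if "(c, \<alpha>) \<in> C" for c \<alpha>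
    proof -
      have "g (- c) \<le> - \<alpha>" using q(3)[OF that] g(2) by (meson le_funD order_trans)
      then show ?thesis using linear_neg[OF lin, of c] by simp
    qed
  qed
qed

section \<open>The tangent half-space in a smooth space\<close>

text \<open>
  If \<open>norm (u - s *\<^sub>R w) \<ge> 1\<close> for all \<open>s > 0\<close>, then \<open>norm (a *\<^sub>R u - b *\<^sub>R w) \<ge> a\<close> for all
  \<open>a, b \<ge> 0\<close>. The Hahn--Banach theorem yields a norm-one \<open>g\<close> with \<open>g u = 1\<close> and \<open>g w \<le> 0\<close>. It differs
  from \<open>f\<close>, against smoothness.
\<close>
lemma norm_decreases_if_smooth:
  fixes u w :: "'e::real_normed_vector" and f :: "'e \<Rightarrow>\<^sub>L real"
  assumes smooth: "smooth_space TYPE('e)"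
    and u: "norm u = 1" and f: "norm f = 1" "f u = 1" and w: "f w > 0"
  obtains s where "s > 0" and "norm (u - s *\<^sub>R w) < 1"
proof (rule ccontr)
  assume "\<not> thesis"
  with that have far: "norm (u - s *\<^sub>R w) \<ge> 1" if "s > 0" for s
    using \<open>s > 0\<close> by force
  define C where "C = {(a *\<^sub>R u - b *\<^sub>R w, a) | a b. a \<ge> 0 \<and> b \<ge> 0}"
  have CI: "(c, a) \<in> C" if "c = a *\<^sub>R u - b *\<^sub>R w" "a \<ge> 0" "b \<ge> 0" for a b c
    using that by (auto simp: C_def)
  have sub: "sublinear (norm :: 'e \<Rightarrow> real)"
    by (simp add: sublinear_def norm_triangle_ineq)
  obtain g where g: "linear g" "\<And>x. g x \<le> norm x" "\<And>c \<alpha>. (c, \<alpha>) \<in> C \<Longrightarrow> \<alpha> \<le> g c"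
  proof (rule Hahn_Banach_cone[OF sub, of C])
    show "(0, 0) \<in> C" by (rule CI[of _ _ 0]) auto
    show "(c + d, \<alpha> + \<beta>) \<in> C" if "(c, \<alpha>) \<in> C" "(d, \<beta>) \<in> C" for c \<alpha> d \<beta>
    proof -
      obtain b b' where "c = \<alpha> *\<^sub>R u - b *\<^sub>R w" "d = \<beta> *\<^sub>R u - b' *\<^sub>R w"
        "\<alpha> \<ge> 0" "b \<ge> 0" "\<beta> \<ge> 0" "b' \<ge> 0"
        using \<open>(c, \<alpha>) \<in> C\<close> \<open>(d, \<beta>) \<in> C\<close> by (auto simp: C_def)
      then show ?thesis
        by (intro CI[of _ _ "b + b'"]) (simp_all add: scaleR_add_left)
    qed
    show "(s *\<^sub>R c, s * \<alpha>) \<in> C" if "(c, \<alpha>) \<in> C" "s > 0" for c \<alpha> s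
    proof -
      obtain b where "c = \<alpha> *\<^sub>R u - b *\<^sub>R w" "\<alpha> \<ge> 0" "b \<ge> 0"
        using \<open>(c, \<alpha>) \<in> C\<close> by (auto simp: C_def)
      then show ?thesis using \<open>s > 0\<close> by (intro CI[of _ _ "s * b"]) (simp_all add: scaleR_diff_right)
    qed
    show "\<alpha> \<le> norm c" if "(c, \<alpha>) \<in> C" for c \<alpha>
    proof -
      obtain b where c: "c = \<alpha> *\<^sub>R u - b *\<^sub>R w" "\<alpha> \<ge> 0" "b \<ge> 0"
        using \<open>(c, \<alpha>) \<in> C\<close> by (auto simp: C_def)
      show ?thesis
      proof (cases "\<alpha> = 0 \<or> b = 0")
        case True
        then show ?thesis using c u by auto
      next
        case False
        then have pos: "\<alpha> > 0" "b > 0" using c by auto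
        then have "c = \<alpha> *\<^sub>R (u - (b / \<alpha>) *\<^sub>R w)" using c by (simp add: algebra_simps)
        then have "norm c = \<alpha> * norm (u - (b / \<alpha>) *\<^sub>R w)" using pos by simp
        also have "\<dots> \<ge> \<alpha> * 1" using far[of "b / \<alpha>"] pos by (intro mult_left_mono) auto
        finally show ?thesis by simp
      qed
    qed
  qed blast
  have abs: "norm (g x) \<le> norm x * 1" for x
    using g(2)[of x] g(2)[of "- x"] linear_neg[OF g(1), of x] by simp
  then have bl: "bounded_linear g"
    using g(1) by (intro bounded_linear_intro[of g 1]) (auto simp: linear_add linear_scale)
  define G where "G = Blinfun g"
  have G: "blinfun_apply G = g" unfolding G_def by (rule bounded_linear_Blinfun_apply[OF bl])
  have gu: "g u = 1"
    using g(3)[OF CI[of u 1 0]] g(2)[of u] u by simp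
  have "norm G \<le> 1" using abs by (intro norm_blinfun_bound) (auto simp: G)
  moreover have "norm G \<ge> 1" using norm_blinfun[of G u] u gu by (simp add: G)
  ultimately have "norm G = 1" by simp
  moreover have "\<exists>!h :: 'e \<Rightarrow>\<^sub>L real. norm h = 1 \<and> blinfun_apply h u = 1"
    using smooth u by (simp add: smooth_space_def)
  ultimately have "G = f" using f gu G by auto
  moreover have "g w \<le> 0" using g(3)[OF CI[of "- w" 0 1]] linear_neg[OF g(1), of w] by simp
  ultimately show False using w G by auto
qed

section \<open>Nearest points under property (Z)\<close>

lemma compact_nearest_point:
  fixes K :: "'a::metric_space set"
  assumes "compact K" and "K \<noteq> {}"
  obtains p where "p \<in> K" and "dist x p = infdist x K"
proof -
  have "continuous_on K (dist x)" by (intro continuous_intros)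
  then obtain p where p: "p \<in> K" "\<And>q. q \<in> K \<Longrightarrow> dist x p \<le> dist x q"
    using continuous_attains_inf[OF assms] by blast
  then have "dist x p \<le> infdist x K"
    using assms(2) by (auto simp: infdist_notempty intro: cINF_greatest)
  then show thesis using that p(1) infdist_le[OF p(1), of x] by simp
qed

lemma rotund_close:
  fixes x :: "'e::real_normed_vector"
  assumes "locally_uniformly_rotund TYPE('e)" and "norm x = 1" and "\<eta> > 0"
  obtains \<delta> where "\<delta> > 0"
    and "\<And>y. norm y = 1 \<Longrightarrow> norm (x + y) \<ge> 2 - \<delta> \<Longrightarrow> norm (x - y) \<le> \<eta>"
proof -
  obtain \<delta> where \<delta>: "\<delta> > 0"
    "\<forall>y\<in>cball 0 1. norm ((1/2) *\<^sub>R (x + y)) \<ge> 1 - \<delta> \<longrightarrow> norm (x - y) \<le> \<eta>"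
    using assms unfolding locally_uniformly_rotund_def sphere_def dist_0_norm by blast
  show thesis
  proof (rule that[of "2 * \<delta>"])
    show "norm (x - y) \<le> \<eta>" if "norm y = 1" "norm (x + y) \<ge> 2 - 2 * \<delta>" for y
      using \<delta>(2) that by simp
  qed (use \<delta> in simp)
qed

text \<open>
  Local uniform rotundity implies strict convexity, here for spheres of any radius: otherwise the two
  normalised points would be within every \<open>\<eta>\<close> of each other.
\<close>
lemma rotund_midpoint:
  fixes a b :: "'e::real_normed_vector"
  assumes lur: "locally_uniformly_rotund TYPE('e)" and "norm a = r" and "norm b = r" and "a \<noteq> b"
  shows "norm (a + b) < 2 * r"
proof (rule ccontr)
  assume *: "\<not> norm (a + b) < 2 * r"
  have r: "r > 0" using assms by (metis norm_eq_zero norm_ge_zero order_less_le)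
  define a' b' where "a' = a /\<^sub>R r" and "b' = b /\<^sub>R r"
  have n: "norm a' = 1" "norm b' = 1" using assms r by (simp_all add: a'_def b'_def)
  have "a' \<noteq> b'" using assms r by (simp add: a'_def b'_def)
  then have pos: "norm (a' - b') / 2 > 0" by simp
  obtain \<delta> where \<delta>: "\<delta> > 0"
    "\<And>y. norm y = 1 \<Longrightarrow> norm (a' + y) \<ge> 2 - \<delta> \<Longrightarrow> norm (a' - y) \<le> norm (a' - b') / 2"
    using rotund_close[OF lur n(1) pos] by blast
  have "a' + b' = (a + b) /\<^sub>R r" by (simp add: a'_def b'_def scaleR_add_right)
  then have "norm (a' + b') = norm (a + b) / r" using r by (simp only: norm_scaleR) (simp add: field_simps)
  then have "norm (a' + b') \<ge> 2" using * r by (simp add: pos_le_divide_eq)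
  then have "norm (a' - b') \<le> norm (a' - b') / 2" using \<delta> n by auto
  then show False using pos by simp
qed

text \<open>
  Put \<open>L = norm (\<tau> - t)\<close>, \<open>s = norm (z - t)\<close>, and let \<open>v\<close>, \<open>u\<close> be the directions from \<open>t\<close> to \<open>\<tau>\<close>
  and to \<open>z\<close>. The hypothesis on \<open>z\<close> gives \<open>norm (v + u) \<ge> 2 - e\<close>, so \<open>u\<close> is close to \<open>v\<close>, and \<open>z\<close>
  differs from \<open>t + s *\<^sub>R v\<close> by a small multiple of \<open>s\<close>. The ball has room for this error: the point at distance
  \<open>s\<close> from \<open>t\<close> on the chord lies inside it at a depth proportional to \<open>s\<close>, by convexity between \<open>t\<close>
  and an interior point \<open>m\<close> of the chord. Since \<open>z\<close> is closer to \<open>t\<close>, the length \<open>s\<close> exceeds \<open>L / 2\<close>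
  at most slightly, which is why \<open>m\<close> is taken at two thirds of the chord.
\<close>
lemma near_chord_in_ball:
  fixes x t \<tau> :: "'e::real_normed_vector"
  assumes lur: "locally_uniformly_rotund TYPE('e)"
    and t: "norm (t - x) = r" and \<tau>: "norm (\<tau> - x) = r" and ne: "t \<noteq> \<tau>"
  obtains e where "e > 0"
    and "\<And>z. z \<noteq> t \<Longrightarrow> dist z t \<le> dist z \<tau> \<Longrightarrow>
           dist t z + dist z \<tau> \<le> dist t \<tau> + e * dist z t \<Longrightarrow> dist x z < r"
proof -
  define L where "L = norm (\<tau> - t)"
  have L: "L > 0" using ne by (simp add: L_def)
  define v where "v = (\<tau> - t) /\<^sub>R L"
  have v: "norm v = 1" and Lv: "L *\<^sub>R v = \<tau> - t" using L by (simp_all add: v_def L_def)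
  define m where "m = t + (2/3) *\<^sub>R (\<tau> - t)"
  have "3 *\<^sub>R (m - x) = 3 *\<^sub>R (t - x) + 2 *\<^sub>R (\<tau> - t)"
    by (simp add: m_def algebra_simps)
  also have "3 *\<^sub>R (t - x) = 2 *\<^sub>R (t - x) + (t - x)"
    using scaleR_add_left[of 2 1 "t - x"] by simp
  finally have "3 *\<^sub>R (m - x) = ((t - x) + (\<tau> - x)) + (\<tau> - x)"
    by (simp add: scaleR_2)
  then have "3 * norm (m - x) \<le> norm ((t - x) + (\<tau> - x)) + norm (\<tau> - x)"
    by (metis abs_numeral norm_scaleR norm_triangle_ineq)
  moreover have "norm ((t - x) + (\<tau> - x)) < 2 * r"
    using ne by (intro rotund_midpoint[OF lur t \<tau>]) simp
  ultimately have mr: "norm (m - x) < r" using \<tau> by simp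
  define \<rho> where "\<rho> = r - norm (m - x)"
  have \<rho>: "\<rho> > 0" using mr by (simp add: \<rho>_def)
  obtain \<delta> where \<delta>: "\<delta> > 0" "\<And>y. norm y = 1 \<Longrightarrow> norm (v + y) \<ge> 2 - \<delta> \<Longrightarrow> norm (v - y) \<le> \<rho> / L"
    using rotund_close[OF lur v, of "\<rho> / L"] \<rho> L by auto
  show thesis
  proof (rule that[of "min (1/2) \<delta>"])
    show "min (1/2) \<delta> > 0" using \<delta> by simp
    fix z assume zt: "z \<noteq> t" and near: "dist z t \<le> dist z \<tau>"
      and Z: "dist t z + dist z \<tau> \<le> dist t \<tau> + min (1/2) \<delta> * dist z t"
    define e where "e = min (1/2) \<delta>"
    have e: "e \<le> 1/2" "e \<le> \<delta>" by (simp_all add: e_def)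
    define s where "s = norm (z - t)"
    have s: "s > 0" using zt by (simp add: s_def)
    define u where "u = (z - t) /\<^sub>R s"
    have u: "norm u = 1" and su: "s *\<^sub>R u = z - t" using s by (simp_all add: u_def s_def)
    have Z': "s + norm (\<tau> - z) \<le> L + e * s" and near': "s \<le> norm (\<tau> - z)"
      using Z near by (simp_all add: s_def L_def e_def dist_norm norm_minus_commute)
    have es: "e * s \<le> s / 2" using e s mult_right_mono[of e "1/2" s] by simp
    have sL: "3 / 2 * s \<le> L" using Z' near' es by simp
    have "(L + s) *\<^sub>R v = (\<tau> - z) + s *\<^sub>R (v + u)"
      unfolding scaleR_add_left scaleR_add_right Lv su by simp
    then have "L + s \<le> norm (\<tau> - z) + s * norm (v + u)"
      using norm_triangle_ineq[of "\<tau> - z" "s *\<^sub>R (v + u)"] v L s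
      by (metis abs_of_pos add_pos_pos mult.right_neutral norm_scaleR)
    then have "s * (2 - e) \<le> s * norm (v + u)" using Z' by (simp add: algebra_simps)
    then have "2 - \<delta> \<le> norm (v + u)" using s e by simp
    then have vu: "norm (v - u) \<le> \<rho> / L" using \<delta> u by blast
    define l where "l = 3 / 2 * s / L"
    have l: "0 < l" "l \<le> 1" using s L sL by (simp_all add: l_def)
    have "l *\<^sub>R (m - t) = (l * (2/3) * L) *\<^sub>R v"
      using Lv by (metis add_diff_cancel_left' m_def scaleR_scaleR)
    then have lm: "l *\<^sub>R (m - t) = s *\<^sub>R v" using L by (simp add: l_def)
    have "z - x = (1 - l) *\<^sub>R (t - x) + l *\<^sub>R (m - x) - s *\<^sub>R (v - u)"
    proof -
      have "(1 - l) *\<^sub>R (t - x) + l *\<^sub>R (m - x) = (t - x) + l *\<^sub>R (m - t)"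
        by (simp add: algebra_simps)
      then show ?thesis using lm su by (simp add: algebra_simps)
    qed
    then have "norm (z - x) \<le> norm ((1 - l) *\<^sub>R (t - x)) + norm (l *\<^sub>R (m - x)) + norm (s *\<^sub>R (v - u))"
      by (metis add_right_mono norm_triangle_ineq norm_triangle_ineq4 order_trans)
    also have "\<dots> = (1 - l) * r + l * (r - \<rho>) + s * norm (v - u)"
      using l s t by (simp add: \<rho>_def)
    also have "\<dots> \<le> (1 - l) * r + l * (r - \<rho>) + s * (\<rho> / L)"
      using vu s by (intro add_left_mono mult_left_mono) auto
    also have "\<dots> = r - s * \<rho> / L / 2"
    proof -
      have "l * \<rho> = 3 / 2 * (s * \<rho> / L)" by (simp add: l_def)
      then show ?thesis by (simp add: algebra_simps)
    qed
    also have "\<dots> < r" using s \<rho> L by simp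
    finally show "dist x z < r" by (simp add: dist_norm norm_minus_commute)
  qed
qed

definition nearest_points_unique :: "'a::metric_space set \<Rightarrow> bool" where
  "nearest_points_unique K \<longleftrightarrow>
    (\<forall>x. \<forall>t\<in>K. \<forall>\<tau>\<in>K. dist x t = infdist x K \<longrightarrow> dist x \<tau> = infdist x K \<longrightarrow> t = \<tau>)"

lemma property_Z_nearest_points_unique:
  fixes K :: "'e::real_normed_vector set"
  assumes lur: "locally_uniformly_rotund TYPE('e)" and Z: "property_Z K"
  shows "nearest_points_unique K"
proof (unfold nearest_points_unique_def, intro allI ballI impI, rule ccontr)
  fix x t \<tau>
  assume t: "t \<in> K" "dist x t = infdist x K" and \<tau>: "\<tau> \<in> K" "dist x \<tau> = infdist x K"
    and ne: "t \<noteq> \<tau>"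
  let ?r = "infdist x K"
  have nt: "norm (t - x) = ?r" and n\<tau>: "norm (\<tau> - x) = ?r"
    using t \<tau> by (simp_all add: dist_norm norm_minus_commute)
  obtain e where e: "e > 0" "\<And>z. z \<noteq> t \<Longrightarrow> dist z t \<le> dist z \<tau> \<Longrightarrow>
      dist t z + dist z \<tau> \<le> dist t \<tau> + e * dist z t \<Longrightarrow> dist x z < ?r"
    using near_chord_in_ball[OF lur nt n\<tau> ne] by blast
  obtain e' where e': "e' > 0" "\<And>z. z \<noteq> \<tau> \<Longrightarrow> dist z \<tau> \<le> dist z t \<Longrightarrow>
      dist \<tau> z + dist z t \<le> dist \<tau> t + e' * dist z \<tau> \<Longrightarrow> dist x z < ?r"
    using near_chord_in_ball[OF lur n\<tau> nt ne[symmetric]] by blast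
  have "min e e' > 0" using e e' by simp
  then obtain z where z: "z \<in> K" "z \<noteq> t" "z \<noteq> \<tau>"
    and le: "dist t z + dist z \<tau> \<le> dist t \<tau> + min e e' * min (dist z t) (dist z \<tau>)"
    using Z t \<tau> ne unfolding property_Z_def by blast
  have "dist x z < ?r"
  proof (cases "dist z t \<le> dist z \<tau>")
    case True
    then have "min e e' * min (dist z t) (dist z \<tau>) \<le> e * dist z t"
      by (simp add: mult_right_mono)
    then show ?thesis using e(2)[OF z(2) True] le by simp
  next
    case False
    then have "min e e' * min (dist z t) (dist z \<tau>) \<le> e' * dist z \<tau>"
      by (simp add: mult_right_mono)
    then show ?thesis using e'(2)[OF z(3)] le False by (simp add: dist_commute)
  qed
  moreover have "?r \<le> dist x z" using z(1) by (rule infdist_le)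
  ultimately show False by simp
qed

section \<open>The distance function of a compact set with unique nearest points\<close>

text \<open>
  Let \<open>q\<close> be nearest to \<open>y = x + s *\<^sub>R (x - p)\<close>. If \<open>q\<close> equalled \<open>p\<close>, the distance would grow by
  exactly \<open>s * d\<close>, where \<open>d\<close> is the distance of \<open>x\<close>; replacing \<open>p\<close> by \<open>q\<close> costs at most
  \<open>s * norm (q - p)\<close>. For small \<open>s\<close> the point \<open>q\<close> is near \<open>p\<close>, because the part of \<open>K\<close> away from \<open>p\<close> is
  compact and thus stays at a distance from \<open>x\<close> strictly greater than \<open>d\<close>.
\<close>
lemma infdist_grows_away_from_nearest:
  fixes K :: "'e::real_normed_vector set"
  assumes K: "compact K"
    and uniq: "nearest_points_unique K" and p: "p \<in> K" "dist x p = infdist x K"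
    and d: "infdist x K > 0" and \<sigma>: "\<sigma> < 1"
  obtains s0 where "s0 > 0"
    and "\<And>s. 0 < s \<Longrightarrow> s \<le> s0 \<Longrightarrow> infdist x K + \<sigma> * (s * infdist x K) \<le> infdist (x + s *\<^sub>R (x - p)) K"
proof -
  define d where "d = infdist x K"
  have d0: "d > 0" using d by (simp add: d_def)
  have xp: "norm (x - p) = d" using p by (simp add: d_def dist_norm)
  define \<eta> where "\<eta> = (1 - \<sigma>) * d"
  have \<eta>: "\<eta> > 0" using d0 \<sigma> by (simp add: \<eta>_def)
  \<comment> \<open>Points of \<open>K\<close> that far from \<open>x\<close> cannot be nearest to a point within \<open>s * d\<close> of \<open>x\<close>.\<close>
  obtain s0 where s0: "s0 > 0"
    and far: "\<And>s q. 0 < s \<Longrightarrow> s \<le> s0 \<Longrightarrow> q \<in> K \<Longrightarrow> dist p q \<ge> \<eta> \<Longrightarrow> d + 2 * (s * d) < dist x q"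
  proof (cases "K - ball p \<eta> = {}")
    case True
    then have "dist p q < \<eta>" if "q \<in> K" for q using that by auto
    then show thesis using that[of 1] by force
  next
    case False
    have "compact (K - ball p \<eta>)" using K by (intro compact_diff) auto
    then obtain k where k: "k \<in> K - ball p \<eta>" "dist x k = infdist x (K - ball p \<eta>)"
      using compact_nearest_point False by metis
    have "k \<noteq> p" using k \<eta> by auto
    then have "dist x k \<noteq> d"
      using uniq p k(1) by (auto simp: nearest_points_unique_def d_def)
    moreover have "d \<le> dist x k" using k(1) by (auto simp: d_def intro: infdist_le)
    ultimately have "d < dist x k" by simp
    define s0 where "s0 = (dist x k - d) / (3 * d)"
    show thesis
    proof (rule that[of s0])
      show "s0 > 0" using \<open>d < dist x k\<close> d0 by (simp add: s0_def)
      fix s q assume s: "0 < s" "s \<le> s0" and q: "q \<in> K" "dist p q \<ge> \<eta>"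
      have "s * d * 3 \<le> dist x k - d" using s d0 by (simp add: s0_def field_simps)
      moreover have "s * d > 0" using s d0 by simp
      moreover have "dist x k \<le> dist x q" using k q by (auto intro: infdist_le)
      ultimately show "d + 2 * (s * d) < dist x q" by linarith
    qed
  qed
  show thesis
  proof (rule that[OF s0])
    fix s assume s: "0 < s" "s \<le> s0"
    define y where "y = x + s *\<^sub>R (x - p)"
    have xy: "dist x y = s * d" using s xp by (simp add: y_def dist_norm)
    obtain q where q: "q \<in> K" "dist y q = infdist y K"
      using compact_nearest_point[OF K] p(1) by blast
    have "dist p q < \<eta>"
    proof (rule ccontr)
      assume "\<not> dist p q < \<eta>"
      then have "d + 2 * (s * d) < dist x q" using far s q by simp
      also have "\<dots> \<le> dist x y + dist y q" by (rule dist_triangle)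
      also have "dist y q \<le> d + s * d"
        using infdist_triangle[of y K x] q xy by (simp add: d_def dist_commute)
      finally show False using xy by simp
    qed
    have "(1 + s) *\<^sub>R (x - q) = (y - q) - s *\<^sub>R (q - p)" by (simp add: y_def algebra_simps)
    then have "(1 + s) * norm (x - q) \<le> norm (y - q) + s * norm (q - p)"
      using norm_triangle_ineq4[of "y - q" "s *\<^sub>R (q - p)"] s
      by (metis abs_of_pos add_pos_pos norm_scaleR zero_less_one)
    moreover have "s * norm (q - p) \<le> s * \<eta>"
      using s \<open>dist p q < \<eta>\<close> by (intro mult_left_mono) (auto simp: dist_norm norm_minus_commute)
    moreover have "(1 + s) * d \<le> (1 + s) * norm (x - q)"
      using s infdist_le[OF q(1), of x] by (intro mult_left_mono) (auto simp: d_def dist_norm)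
    ultimately have "(1 + s) * d - s * \<eta> \<le> infdist y K" using q(2) by (simp add: dist_norm)
    then show "infdist x K + \<sigma> * (s * infdist x K) \<le> infdist (x + s *\<^sub>R (x - p)) K"
      by (simp add: y_def d_def \<eta>_def algebra_simps)
  qed
qed

text \<open>
  Write \<open>F y\<close> for the points that lie above \<open>y\<close> by at least \<open>\<sigma>\<close> times their distance to \<open>y\<close>. By the
  triangle inequality membership in \<open>F\<close> is a preorder. Move repeatedly to a point of \<open>F\<close> where \<open>h\<close> is
  almost as large as possible. The values of \<open>h\<close> increase and are bounded, so the path has
  finite length and converges; its limit \<open>y\<close> has \<open>F y = {y}\<close>.
\<close>
theorem Ekeland_variational_principle:
  fixes h :: "'a::complete_space \<Rightarrow> real"
  assumes S: "closed S" "x \<in> S" and cont: "continuous_on S h" and bdd: "bdd_above (h ` S)"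
    and \<sigma>: "\<sigma> > 0"
  obtains y where "y \<in> S" and "h x + \<sigma> * dist x y \<le> h y"
    and "\<And>z. z \<in> S \<Longrightarrow> h y + \<sigma> * dist y z \<le> h z \<Longrightarrow> z = y"
proof -
  define F where "F = (\<lambda>y. {z\<in>S. h y + \<sigma> * dist y z \<le> h z})"
  have F_refl: "y \<in> F y" if "y \<in> S" for y using that by (simp add: F_def)
  have F_trans: "c \<in> F a" if "b \<in> F a" "c \<in> F b" for a b c
  proof -
    have "\<sigma> * dist a c \<le> \<sigma> * (dist a b + dist b c)"
      using \<sigma> by (intro mult_left_mono dist_triangle) auto
    then show ?thesis using that by (simp add: F_def algebra_simps)
  qed
  have "\<exists>z. z \<in> S \<and> (z \<in> F y \<and> (\<forall>w\<in>F y. h w \<le> h z + 1 / real (Suc n)))" if "y \<in> S" for y n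
  proof -
    have bF: "bdd_above (h ` F y)" using bdd by (rule bdd_above_mono) (auto simp: F_def)
    have "F y \<noteq> {}" using F_refl that by blast
    then obtain z where "z \<in> F y" "Sup (h ` F y) - 1 / real (Suc n) < h z"
      using less_cSUP_iff[of "F y" h "Sup (h ` F y) - 1 / real (Suc n)"] bF by auto
    moreover have "h w \<le> Sup (h ` F y)" if "w \<in> F y" for w
      using that bF by (rule cSUP_upper)
    ultimately have "z \<in> S \<and> z \<in> F y \<and> (\<forall>w\<in>F y. h w \<le> h z + 1 / real (Suc n))"
      by (force simp: F_def)
    then show ?thesis by blast
  qed
  then have "\<exists>X. \<forall>n. (X n \<in> S \<and> (n = 0 \<longrightarrow> X n = x)) \<and>
      (X (Suc n) \<in> F (X n) \<and> (\<forall>w\<in>F (X n). h w \<le> h (X (Suc n)) + 1 / real (Suc n)))"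
    by (intro dependent_nat_choice) (use S(2) in simp_all)
  then obtain X where XS: "\<And>n. X n \<in> S" and X0: "X 0 = x" and X: "\<And>n. X (Suc n) \<in> F (X n)"
    and almost: "\<And>n w. w \<in> F (X n) \<Longrightarrow> h w \<le> h (X (Suc n)) + 1 / real (Suc n)"
    by metis
  have XF: "X n \<in> F (X m)" if "m \<le> n" for m n
    using that by (induction n rule: dec_induct) (auto intro: F_refl F_trans XS X)
  have gap: "\<sigma> * dist (X m) (X n) \<le> h (X n) - h (X m)" if "m \<le> n" for m n
    using XF[OF that] by (simp add: F_def)
  have mono: "incseq (\<lambda>n. h (X n))"
    using gap \<sigma> by (intro incseq_SucI) (smt (verit) le_Suc_eq mult_nonneg_nonneg order_refl zero_le_dist)
  have "bdd_above (range (\<lambda>n. h (X n)))" using bdd by (rule bdd_above_mono) (use XS in auto)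
  then have "convergent (\<lambda>n. h (X n))"
    using mono by (meson LIMSEQ_incseq_SUP convergentI)
  then have "Cauchy (\<lambda>n. h (X n))" by (rule convergent_Cauchy)
  have "Cauchy X"
  proof (rule metric_CauchyI)
    fix e :: real assume e: "e > 0"
    then obtain M where M: "\<And>m n. m \<ge> M \<Longrightarrow> n \<ge> M \<Longrightarrow> dist (h (X m)) (h (X n)) < \<sigma> * e"
      using metric_CauchyD[OF \<open>Cauchy (\<lambda>n. h (X n))\<close>, of "\<sigma> * e"] \<sigma> by auto
    have *: "dist (X m) (X n) < e" if "M \<le> m" "m \<le> n" for m n
    proof -
      have "\<sigma> * dist (X m) (X n) < \<sigma> * e"
        using gap[OF that(2)] M[of m n] that by (simp add: dist_real_def)
      then show ?thesis using \<sigma> by simp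
    qed
    show "\<exists>M. \<forall>m\<ge>M. \<forall>n\<ge>M. dist (X m) (X n) < e"
      using * by (metis dist_commute nle_le)
  qed
  then obtain y where y: "X \<longlonglongrightarrow> y" using Cauchy_convergent convergent_def by blast
  have yS: "y \<in> S" using S(1) XS y by (rule closed_sequentially)
  have hy: "(\<lambda>n. h (X n)) \<longlonglongrightarrow> h y"
    using cont yS y XS by (intro continuous_on_tendsto_compose[of S h X y]) simp_all
  have yF: "y \<in> F (X n)" for n
  proof -
    have "h (X n) + \<sigma> * dist (X n) y \<le> h y"
    proof (rule LIMSEQ_le)
      show "(\<lambda>m. h (X n) + \<sigma> * dist (X n) (X m)) \<longlonglongrightarrow> h (X n) + \<sigma> * dist (X n) y"
        by (intro tendsto_intros y)
      show "\<exists>N. \<forall>m\<ge>N. h (X n) + \<sigma> * dist (X n) (X m) \<le> h (X m)"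
        using gap by (intro exI[of _ n]) force
    qed (rule hy)
    then show ?thesis using yS by (simp add: F_def)
  qed
  show thesis
  proof (rule that[OF yS])
    show "h x + \<sigma> * dist x y \<le> h y" using yF[of 0] X0 by (simp add: F_def)
    fix z assume "z \<in> S" and z: "h y + \<sigma> * dist y z \<le> h z"
    then have "z \<in> F (X n)" for n using F_trans[OF yF] by (simp add: F_def)
    then have "h z \<le> h (X (Suc n)) + 1 / real (Suc n)" for n by (rule almost)
    moreover have "(\<lambda>n. h (X (Suc n)) + 1 / real (Suc n)) \<longlonglongrightarrow> h y + 0"
      by (intro tendsto_add LIMSEQ_Suc[OF hy] LIMSEQ_Suc[OF lim_1_over_n])
    ultimately have "h z \<le> h y" using LIMSEQ_le_const by fastforce
    then have "\<sigma> * dist y z \<le> 0" using z by simp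
    then show "z = y" using \<sigma> by (simp add: mult_le_0_iff)
  qed
qed

text \<open>
  Apply Ekeland's principle to the distance function on the ball of radius \<open>R\<close> about \<open>x\<close>. At a
  maximal point inside the open ball, a small step away from its nearest point would still be
  admissible; hence the maximal point lies on the boundary sphere.
\<close>
lemma infdist_steep_far_point:
  fixes K :: "'e::banach set"
  assumes K: "compact K" "K \<noteq> {}"
    and uniq: "nearest_points_unique K"
    and x: "x \<notin> K" and \<sigma>: "0 < \<sigma>" "\<sigma> < 1" and R: "R > 0"
  obtains y where "dist x y = R" and "infdist x K + \<sigma> * R \<le> infdist y K"
proof -
  let ?h = "\<lambda>y. infdist y K"
  have "closed K" using K by (simp add: compact_imp_closed)
  have pos: "?h x > 0"
    using x \<open>closed K\<close> K(2) by (metis in_closed_iff_infdist_zero infdist_nonneg order_less_le)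
  have "bdd_above (?h ` cball x R)"
  proof (rule bdd_aboveI2)
    show "?h y \<le> ?h x + R" if "y \<in> cball x R" for y
      using infdist_triangle[of y K x] that by (simp add: dist_commute)
  qed
  moreover have "continuous_on (cball x R) ?h" by (intro continuous_intros)
  ultimately obtain y where y: "y \<in> cball x R" "?h x + \<sigma> * dist x y \<le> ?h y"
    and max: "\<And>z. z \<in> cball x R \<Longrightarrow> ?h y + \<sigma> * dist y z \<le> ?h z \<Longrightarrow> z = y"
    using Ekeland_variational_principle[of "cball x R" x ?h \<sigma>] R \<sigma>(1)
    by (auto simp del: mem_cball)
  have "dist x y = R"
  proof (rule ccontr)
    assume "dist x y \<noteq> R"
    then have lt: "dist x y < R" using y by simp
    have "\<sigma> * dist x y \<ge> 0" using \<sigma> by simp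
    then have hy: "?h y > 0" using y(2) pos by simp
    obtain p where p: "p \<in> K" "dist y p = ?h y"
      using compact_nearest_point[OF K] by metis
    obtain s0 where s0: "s0 > 0" "\<And>s. 0 < s \<Longrightarrow> s \<le> s0 \<Longrightarrow>
        ?h y + \<sigma> * (s * ?h y) \<le> ?h (y + s *\<^sub>R (y - p))"
      using infdist_grows_away_from_nearest[OF K(1) uniq p hy \<sigma>(2)] by metis
    define s where "s = min s0 ((R - dist x y) / ?h y)"
    define z where "z = y + s *\<^sub>R (y - p)"
    have s: "0 < s" "s \<le> s0" "s * ?h y \<le> R - dist x y"
      using s0 lt hy by (auto simp: s_def min_def field_simps)
    have yz: "dist y z = s * ?h y" using s p by (simp add: z_def dist_norm)
    have "z \<in> cball x R" using dist_triangle[of x z y] yz s by simp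
    moreover have "?h y + \<sigma> * dist y z \<le> ?h z" using s0(2)[OF s(1,2)] yz by (simp add: z_def)
    ultimately have "z = y" by (rule max)
    then show False using yz s hy by simp
  qed
  then show thesis using that y by simp
qed

text \<open>
  The far point \<open>y\<close> satisfies \<open>norm (y - p) \<ge> d + R - c\<close> with small \<open>c\<close>, while \<open>y - p\<close> is the sum of a
  vector of length \<open>d\<close> in direction \<open>u\<close> and one of length \<open>R\<close> in direction \<open>v\<close>. So the triangle
  inequality is nearly sharp, \<open>norm (u + v)\<close> is nearly \<open>2\<close>, and \<open>v\<close> is close to \<open>u\<close>. Now \<open>c\<close> tends
  to \<open>0\<close>, and the distance function is continuous.
\<close>
lemma infdist_along_ray:
  fixes K :: "'e::banach set"
  assumes lur: "locally_uniformly_rotund TYPE('e)" and K: "compact K"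
    and uniq: "nearest_points_unique K"
    and x: "x \<notin> K" and p: "p \<in> K" "dist x p = infdist x K" and R: "R > 0"
    and u: "norm u = 1" "x = p + infdist x K *\<^sub>R u"
  shows "infdist x K + R \<le> infdist (x + R *\<^sub>R u) K"
proof (rule field_le_epsilon)
  fix e :: real assume e: "e > 0"
  define d where "d = infdist x K"
  have d: "d > 0" using p x by (metis d_def dist_nz)
  have "e / (2 * R) > 0" using e R by simp
  then obtain \<delta> where \<delta>: "\<delta> > 0"
    "\<And>v. norm v = 1 \<Longrightarrow> norm (u + v) \<ge> 2 - \<delta> \<Longrightarrow> norm (u - v) \<le> e / (2 * R)"
    using rotund_close[OF lur u(1)] by metis
  \<comment> \<open>\<open>M\<close> is the common length that pairs off \<open>u\<close> with \<open>v\<close> in \<open>d *\<^sub>R u + R *\<^sub>R v\<close>.\<close>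
  define M where "M = min d R"
  have M: "M > 0" "M \<le> d" "M \<le> R" using d R by (auto simp: M_def)
  define c where "c = min (R / 2) (min (e / 2) (M * \<delta>))"
  have c: "c > 0" "c < R" "c \<le> e / 2" "c \<le> M * \<delta>" using R e M \<delta> by (auto simp: c_def)
  define \<sigma> where "\<sigma> = 1 - c / R"
  have \<sigma>: "0 < \<sigma>" "\<sigma> < 1" "\<sigma> * R = R - c" using c R by (auto simp: \<sigma>_def field_simps)
  obtain y where y: "dist x y = R" "d + \<sigma> * R \<le> infdist y K"
    using infdist_steep_far_point[OF K _ uniq x \<sigma>(1,2) R] p unfolding d_def by blast
  define v where "v = (y - x) /\<^sub>R R"
  have v: "norm v = 1" and Rv: "y = x + R *\<^sub>R v"
    using y R by (simp_all add: v_def dist_norm norm_minus_commute)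
  have "d + R - c \<le> norm (y - p)"
    using y(2) infdist_le[OF p(1), of y] \<sigma>(3) by (simp add: dist_norm)
  also have "y - p = M *\<^sub>R (u + v) + (d - M) *\<^sub>R u + (R - M) *\<^sub>R v"
    using Rv u(2) by (simp add: d_def algebra_simps)
  also have "norm \<dots> \<le> M * norm (u + v) + (d - M) + (R - M)"
    using M u v by (intro norm_triangle_le add_mono) simp_all
  finally have "M * (2 - \<delta>) \<le> M * norm (u + v)" using c by (simp add: algebra_simps)
  then have "norm (u - v) \<le> e / (2 * R)" using \<delta>(2) v M by simp
  then have "R * norm (v - u) \<le> e / 2" using R by (simp add: field_simps norm_minus_commute)
  moreover have "dist y (x + R *\<^sub>R u) = R * norm (v - u)"
    using R Rv by (simp add: dist_norm flip: scaleR_diff_right)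
  ultimately have "infdist y K \<le> infdist (x + R *\<^sub>R u) K + e / 2"
    using infdist_triangle[of y K "x + R *\<^sub>R u"] by simp
  then show "infdist x K + R \<le> infdist (x + R *\<^sub>R u) K + e"
    using y(2) \<sigma>(3) c(3) by (simp add: d_def)
qed

section \<open>Separation and convexity\<close>

text \<open>
  The functional is the one that supports the unit ball at \<open>u\<close>, the direction from \<open>p\<close> to \<open>x\<close>. A
  point \<open>k\<close> with \<open>f k > f p\<close> lies in the ball of radius \<open>d + R\<close> about \<open>x + R *\<^sub>R u\<close> for large \<open>R\<close>:
  after scaling by \<open>s' = 1 / (d + R)\<close> this says that \<open>u - s' *\<^sub>R (k - p)\<close> lies in the open unit ball.
\<close>
lemma nearest_point_separates:
  fixes K :: "'e::banach set"
  assumes smooth: "smooth_space TYPE('e)"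
    and lur: "locally_uniformly_rotund TYPE('e)" and K: "compact K"
    and uniq: "nearest_points_unique K"
    and x: "x \<notin> K" and p: "p \<in> K" "dist x p = infdist x K"
  obtains f :: "'e \<Rightarrow>\<^sub>L real" where "\<And>k. k \<in> K \<Longrightarrow> f k \<le> f p" and "f p < f x"
proof -
  define d where "d = infdist x K"
  have d: "d > 0" using p x by (metis d_def dist_nz)
  define u where "u = (x - p) /\<^sub>R d"
  have u: "norm u = 1" and xu: "x = p + d *\<^sub>R u"
    using d p by (simp_all add: u_def d_def dist_norm)
  obtain f :: "'e \<Rightarrow>\<^sub>L real" where f: "norm f = 1" "f u = 1"
    using smooth u unfolding smooth_space_def sphere_def dist_0_norm by blast
  show thesis
  proof (rule that)
    show "f p < f x" using d f by (simp add: xu blinfun.add_right blinfun.scaleR_right)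
    fix k assume k: "k \<in> K"
    show "f k \<le> f p"
    proof (rule ccontr)
      define w where "w = k - p"
      assume "\<not> f k \<le> f p"
      then have "f w > 0" by (simp add: w_def blinfun.diff_right)
      then obtain s where s: "s > 0" "norm (u - s *\<^sub>R w) < 1"
        using norm_decreases_if_smooth[OF smooth u f] by metis
      \<comment> \<open>The bound by \<open>1 / (2 * d)\<close> makes \<open>R\<close> below positive.\<close>
      define s' where "s' = min s (1 / (2 * d))"
      have s': "s' > 0" "s' \<le> s" "s' \<le> 1 / (2 * d)" using s d by (auto simp: s'_def)
      \<comment> \<open>The norm is convex, so a smaller step along the same segment stays inside the ball.\<close>
      have "norm (u - s' *\<^sub>R w) < 1"
      proof -
        define l where "l = s' / s"
        have l: "0 < l" "l \<le> 1" using s s' by (auto simp: l_def)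
        have "u - s' *\<^sub>R w = (1 - l) *\<^sub>R u + l *\<^sub>R (u - s *\<^sub>R w)"
          using s by (simp add: l_def algebra_simps)
        also have "norm \<dots> \<le> (1 - l) * 1 + l * norm (u - s *\<^sub>R w)"
          using l u by (intro norm_triangle_le) simp
        also have "\<dots> < (1 - l) * 1 + l * 1"
          using l s by (intro add_strict_left_mono mult_strict_left_mono)
        finally show ?thesis by simp
      qed
      define R where "R = 1 / s' - d"
      have "2 * d \<le> 1 / s'" using s' d by (simp add: field_simps)
      then have R: "R > 0" using d by (simp add: R_def)
      have "x + R *\<^sub>R u - k = (1 / s') *\<^sub>R (u - s' *\<^sub>R w)"
        using s' by (simp add: R_def xu w_def algebra_simps)
      then have "dist (x + R *\<^sub>R u) k = (1 / s') * norm (u - s' *\<^sub>R w)"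
        using s' by (simp add: dist_norm)
      also have "\<dots> < 1 / s'" using \<open>norm (u - s' *\<^sub>R w) < 1\<close> s' by (simp add: field_simps)
      also have "\<dots> = d + R" by (simp add: R_def)
      also have "\<dots> \<le> infdist (x + R *\<^sub>R u) K"
        using infdist_along_ray[OF lur K uniq x p R u] xu unfolding d_def by blast
      also have "\<dots> \<le> dist (x + R *\<^sub>R u) k" using k by (rule infdist_le)
      finally show False by simp
    qed
  qed
qed

theorem proposition2p9:
  fixes K :: "'e::banach set"
  assumes "smooth_space TYPE('e)"
    and "locally_uniformly_rotund TYPE('e)"
    and "compact K"
    and "property_Z K"
  shows "convex K"
proof (rule convexI)
  fix a b and l m :: real
  assume ab: "a \<in> K" "b \<in> K" and lm: "0 \<le> l" "0 \<le> m" "l + m = 1"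
  let ?x = "l *\<^sub>R a + m *\<^sub>R b"
  show "?x \<in> K"
  proof (rule ccontr)
    assume x: "?x \<notin> K"
    obtain p where p: "p \<in> K" "dist ?x p = infdist ?x K"
      using compact_nearest_point[OF assms(3)] ab(1) by blast
    obtain f :: "'e \<Rightarrow>\<^sub>L real" where f: "\<And>k. k \<in> K \<Longrightarrow> f k \<le> f p" "f p < f ?x"
      using nearest_point_separates[OF assms(1-3) _ x p] property_Z_nearest_points_unique[OF assms(2,4)]
      by metis
    have "f ?x = l * f a + m * f b" by (simp add: blinfun.add_right blinfun.scaleR_right)
    also have "\<dots> \<le> l * f p + m * f p" using f ab lm by (intro add_mono mult_left_mono) auto
    also have "\<dots> = f p" using lm by (simp flip: distrib_right)
    finally show False using f by simp
  qed
qed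

end
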